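(* Let $K$ be a field of characteristic zero, $A$ a commutative associative unital $K$-algebra and $G$ an $A$-module. Suppose that $\mathcal G=\bigwedge_AG$, with its exterior product, carries a Gerstenhaber bracket $[\cdot,\cdot]$ of degree $-1$. Define \[ \rho(x)(a)=[x,a],\qquad [x,y]_G=[x,y],\qquad a\in A,\ x,y\in G. \] Then $(G,[\cdot,\cdot]_G,\rho)$ is a Lie--Rinehart algebra over $A$.
   Context: A Lie--Rinehart algebra over $A$ is an $A$-module $G$ endowed with a $K$-Lie bracket $[\cdot,\cdot]_G$ and an $A$-linear map $\rho:G\to\operatorname{Der}_K(A)$ (the anchor) that is a morphism of $K$-Lie algebras, such that $[x,ay]_G=a[x,y]_G+\rho(x)(a)y$ for all $a\in A$, $x,y\in G$. $\mathcal G=\bigwedge_AG=\bigoplus_{p\ge0}\mathcal G^p$ is the exterior algebra over $A$, $\mathcal G^p=\bigwedge_A^pG$, with $\mathcal G^0=A$, $\mathcal G^1=G$ and $\mathcal G^p=0$ for $p<0$. A Gerstenhaber bracket of degree $-1$ on $(\mathcal G,\wedge)$ is a $K$-bilinear map $[\cdot,\cdot]:\mathcal G\times\mathcal G\to\mathcal G$ with $[\mathcal G^p,\mathcal G^q]\subseteq\mathcal G^{p+q-1}$ such that for homogeneous $P\in\mathcal G^p$, $Q\in\mathcal G^q$, $R\in\mathcal G^r$, \[ [P,Q]=-(-1)^{(p-1)(q-1)}[Q,P], \] \[ (-1)^{(p-1)(r-1)}[P,[Q,R]]+(-1)^{(q-1)(p-1)}[Q,[R,P]]+(-1)^{(r-1)(q-1)}[R,[P,Q]]=0,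 \] \[ [P,Q\wedge R]=[P,Q]\wedge R+(-1)^{(p-1)q}Q\wedge[P,R]. \] For degree reasons $[A,A]=0$, $[G,A]\subseteq A$ and $[G,G]\subseteq G$, so that $\rho(x)(a)\in A$ and $[x,y]_G\in G$. *)

theory Defs
  imports "HOL-Algebra.Module" "HOL-Algebra.QuotRing"
begin

section \<open>Lie algebras, derivations, Lie--Rinehart algebras\<close>

text \<open>An \<open>A\<close>-module (or \<open>A\<close>-algebra) viewed as a \<open>K\<close>-module (\<open>K\<close>-algebra) along
  \<open>K \<rightarrow> A\<close>, \<open>k \<mapsto> k 1\<close>.\<close>

definition restrict_scalars ::
    "('k, 'm) ring_scheme \<Rightarrow> ('k, 'a, 'n) module_scheme \<Rightarrow> ('a, 'b, 'p) module_scheme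
      \<Rightarrow> ('k, 'b) module" where
  "restrict_scalars K A M =
    \<lparr> carrier = carrier M, mult = mult M, one = one M, zero = zero M, add = add M,
      smult = (\<lambda>k x. (k \<odot>\<^bsub>A\<^esub> \<one>\<^bsub>A\<^esub>) \<odot>\<^bsub>M\<^esub> x) \<rparr>"

definition bilinear_on ::
    "('k, 'm) ring_scheme \<Rightarrow> ('k, 'b, 'p) module_scheme \<Rightarrow> ('b \<Rightarrow> 'b \<Rightarrow> 'b) \<Rightarrow> bool" where
  "bilinear_on K M f \<longleftrightarrow>
    f \<in> carrier M \<rightarrow> carrier M \<rightarrow> carrier M \<and>
    (\<forall>x\<in>carrier M. \<forall>y\<in>carrier M. \<forall>z\<in>carrier M.
      f (x \<oplus>\<^bsub>M\<^esub> y) z = f x z \<oplus>\<^bsub>M\<^esub> f y z \<and> f z (x \<oplus>\<^bsub>M\<^esub> y) = f z x \<oplus>\<^bsub>M\<^esub> f z y) \<and>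
    (\<forall>k\<in>carrier K. \<forall>x\<in>carrier M. \<forall>y\<in>carrier M.
      f (k \<odot>\<^bsub>M\<^esub> x) y = k \<odot>\<^bsub>M\<^esub> f x y \<and> f x (k \<odot>\<^bsub>M\<^esub> y) = k \<odot>\<^bsub>M\<^esub> f x y)"

locale lie_algebra = module K L for K (structure) and L (structure) +
  fixes br :: "'c \<Rightarrow> 'c \<Rightarrow> 'c"
  assumes br_bilinear: "bilinear_on K L br"
    and br_alternating: "x \<in> carrier L \<Longrightarrow> br x x = \<zero>\<^bsub>L\<^esub>"
    and br_jacobi:
      "\<lbrakk> x \<in> carrier L; y \<in> carrier L; z \<in> carrier L \<rbrakk> \<Longrightarrow>
        br x (br y z) \<oplus>\<^bsub>L\<^esub> br y (br z x) \<oplus>\<^bsub>L\<^esub> br z (br x y) = \<zero>\<^bsub>L\<^esub>"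

definition Der :: "('k, 'm) ring_scheme \<Rightarrow> ('k, 'a, 'n) module_scheme \<Rightarrow> ('a \<Rightarrow> 'a) set" where
  "Der K A = {D \<in> carrier A \<rightarrow> carrier A.
    (\<forall>a\<in>carrier A. \<forall>b\<in>carrier A. D (a \<oplus>\<^bsub>A\<^esub> b) = D a \<oplus>\<^bsub>A\<^esub> D b) \<and>
    (\<forall>k\<in>carrier K. \<forall>a\<in>carrier A. D (k \<odot>\<^bsub>A\<^esub> a) = k \<odot>\<^bsub>A\<^esub> D a) \<and>
    (\<forall>a\<in>carrier A. \<forall>b\<in>carrier A. D (a \<otimes>\<^bsub>A\<^esub> b) = D a \<otimes>\<^bsub>A\<^esub> b \<oplus>\<^bsub>A\<^esub> a \<otimes>\<^bsub>A\<^esub> D b)}"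

text \<open>The module and Lie algebra structures of \<open>Der\<^sub>K(A)\<close> are pointwise multiplication and the
  commutator; equality of derivations is equality on the carrier of \<open>A\<close>.\<close>

locale lie_rinehart =
  algebra K A + G: module A G + G: lie_algebra K "restrict_scalars K A G" lb
  for K (structure) and A (structure) and G (structure) and lb :: "'c \<Rightarrow> 'c \<Rightarrow> 'c" +
  fixes \<rho> :: "'c \<Rightarrow> 'b \<Rightarrow> 'b"
  assumes anchor_Der: "x \<in> carrier G \<Longrightarrow> \<rho> x \<in> Der K A"
    and anchor_add:
      "\<lbrakk> x \<in> carrier G; y \<in> carrier G; a \<in> carrier A \<rbrakk> \<Longrightarrow>
        \<rho> (x \<oplus>\<^bsub>G\<^esub> y) a = \<rho> x a \<oplus>\<^bsub>A\<^esub> \<rho> y a"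
    and anchor_smult:
      "\<lbrakk> b \<in> carrier A; x \<in> carrier G; a \<in> carrier A \<rbrakk> \<Longrightarrow>
        \<rho> (b \<odot>\<^bsub>G\<^esub> x) a = b \<otimes>\<^bsub>A\<^esub> \<rho> x a"
    and anchor_bracket:
      "\<lbrakk> x \<in> carrier G; y \<in> carrier G; a \<in> carrier A \<rbrakk> \<Longrightarrow>
        \<rho> (lb x y) a = \<rho> x (\<rho> y a) \<ominus>\<^bsub>A\<^esub> \<rho> y (\<rho> x a)"
    and leibniz:
      "\<lbrakk> a \<in> carrier A; x \<in> carrier G; y \<in> carrier G \<rbrakk> \<Longrightarrow>
        lb x (a \<odot>\<^bsub>G\<^esub> y) = a \<odot>\<^bsub>G\<^esub> lb x y \<oplus>\<^bsub>G\<^esub> \<rho> x a \<odot>\<^bsub>G\<^esub> y"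


section \<open>The exterior algebra of a module\<close>

text \<open>The free associative unital \<open>A\<close>-algebra on the set \<open>carrier G\<close>: finitely supported
  functions from words in \<open>carrier G\<close> to \<open>A\<close>, with the convolution product induced by
  concatenation of words.\<close>

definition free_alg :: "('a, 'm) ring_scheme \<Rightarrow> ('g, 'n) ring_scheme \<Rightarrow> ('g list \<Rightarrow> 'a) ring" where
  "free_alg A G =
    \<lparr> carrier = {f. range f \<subseteq> carrier A \<and> finite {w. f w \<noteq> \<zero>\<^bsub>A\<^esub>} \<and>
                    (\<forall>w. f w \<noteq> \<zero>\<^bsub>A\<^esub> \<longrightarrow> set w \<subseteq> carrier G)},
      mult = (\<lambda>f g w. \<Oplus>\<^bsub>A\<^esub>i\<in>{..length w}. f (take i w) \<otimes>\<^bsub>A\<^esub> g (drop i w)),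
      one = (\<lambda>w. if w = [] then \<one>\<^bsub>A\<^esub> else \<zero>\<^bsub>A\<^esub>),
      zero = (\<lambda>w. \<zero>\<^bsub>A\<^esub>),
      add = (\<lambda>f g w. f w \<oplus>\<^bsub>A\<^esub> g w) \<rparr>"

definition term_of :: "('a, 'm) ring_scheme \<Rightarrow> 'a \<Rightarrow> 'g list \<Rightarrow> ('g list \<Rightarrow> 'a)" where
  "term_of A a w = (\<lambda>v. if v = w then a else \<zero>\<^bsub>A\<^esub>)"

text \<open>The first two families of relations cut the free algebra down to the tensor algebra
  \<open>T\<^sub>A(G)\<close>; the third one imposes \<open>x \<otimes> x = 0\<close>.\<close>

definition ext_relations ::
    "('a, 'm) ring_scheme \<Rightarrow> ('a, 'g, 'n) module_scheme \<Rightarrow> ('g list \<Rightarrow> 'a) set" where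
  "ext_relations A G =
    {term_of A \<one>\<^bsub>A\<^esub> [x \<oplus>\<^bsub>G\<^esub> y] \<ominus>\<^bsub>free_alg A G\<^esub>
       (term_of A \<one>\<^bsub>A\<^esub> [x] \<oplus>\<^bsub>free_alg A G\<^esub> term_of A \<one>\<^bsub>A\<^esub> [y]) | x y.
       x \<in> carrier G \<and> y \<in> carrier G} \<union>
    {term_of A \<one>\<^bsub>A\<^esub> [a \<odot>\<^bsub>G\<^esub> x] \<ominus>\<^bsub>free_alg A G\<^esub> term_of A a [x] | a x.
       a \<in> carrier A \<and> x \<in> carrier G} \<union>
    {term_of A \<one>\<^bsub>A\<^esub> [x, x] | x. x \<in> carrier G}"

definition ext_ideal ::
    "('a, 'm) ring_scheme \<Rightarrow> ('a, 'g, 'n) module_scheme \<Rightarrow> ('g list \<Rightarrow> 'a) set" where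
  "ext_ideal A G = Idl\<^bsub>free_alg A G\<^esub> (ext_relations A G)"

definition ext_class ::
    "('a, 'm) ring_scheme \<Rightarrow> ('a, 'g, 'n) module_scheme \<Rightarrow> ('g list \<Rightarrow> 'a) \<Rightarrow> ('g list \<Rightarrow> 'a) set" where
  "ext_class A G f = ext_ideal A G +>\<^bsub>free_alg A G\<^esub> f"

text \<open>The canonical maps \<open>A \<rightarrow> \<And>A G\<close> and \<open>G \<rightarrow> \<And>A G\<close>.\<close>

definition ext_scalar ::
    "('a, 'm) ring_scheme \<Rightarrow> ('a, 'g, 'n) module_scheme \<Rightarrow> 'a \<Rightarrow> ('g list \<Rightarrow> 'a) set" where
  "ext_scalar A G a = ext_class A G (term_of A a [])"

definition ext_vector ::
    "('a, 'm) ring_scheme \<Rightarrow> ('a, 'g, 'n) module_scheme \<Rightarrow> 'g \<Rightarrow> ('g list \<Rightarrow> 'a) set" where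
  "ext_vector A G x = ext_class A G (term_of A \<one>\<^bsub>A\<^esub> [x])"

definition exterior_algebra ::
    "('a, 'm) ring_scheme \<Rightarrow> ('a, 'g, 'n) module_scheme \<Rightarrow> ('a, ('g list \<Rightarrow> 'a) set) module" where
  "exterior_algebra A G =
    ring.extend (free_alg A G Quot ext_ideal A G)
      (module.fields (\<lambda>a P. ext_scalar A G a \<otimes>\<^bsub>free_alg A G Quot ext_ideal A G\<^esub> P))"

text \<open>The \<open>p\<close>-th exterior power is spanned by the classes of words of length \<open>p\<close>; for \<open>p < 0\<close>
  there are no such words and only the class of \<open>0\<close> remains.\<close>

definition exterior_power ::
    "('a, 'm) ring_scheme \<Rightarrow> ('a, 'g, 'n) module_scheme \<Rightarrow> int \<Rightarrow> ('g list \<Rightarrow> 'a) set set" where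
  "exterior_power A G p =
    ext_class A G ` {f \<in> carrier (free_alg A G). \<forall>w. f w \<noteq> \<zero>\<^bsub>A\<^esub> \<longrightarrow> int (length w) = p}"


section \<open>Gerstenhaber brackets\<close>

text \<open>\<open>(-1)\<^sup>n P\<close>, for an integer \<open>n\<close> of any sign.\<close>

definition signed :: "('e, 'm) ring_scheme \<Rightarrow> int \<Rightarrow> 'e \<Rightarrow> 'e" where
  "signed E n P = (if even n then P else \<ominus>\<^bsub>E\<^esub> P)"

definition gerstenhaber_bracket ::
    "('k, 'm) ring_scheme \<Rightarrow> ('k, 'e, 'n) module_scheme \<Rightarrow> (int \<Rightarrow> 'e set) \<Rightarrow>
      ('e \<Rightarrow> 'e \<Rightarrow> 'e) \<Rightarrow> bool" where
  "gerstenhaber_bracket K E gr br \<longleftrightarrow>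
    bilinear_on K E br \<and>
    (\<forall>p q. \<forall>P\<in>gr p. \<forall>Q\<in>gr q. br P Q \<in> gr (p + q - 1)) \<and>
    (\<forall>p q. \<forall>P\<in>gr p. \<forall>Q\<in>gr q.
      br P Q = \<ominus>\<^bsub>E\<^esub> signed E ((p - 1) * (q - 1)) (br Q P)) \<and>
    (\<forall>p q r. \<forall>P\<in>gr p. \<forall>Q\<in>gr q. \<forall>R\<in>gr r.
      signed E ((p - 1) * (r - 1)) (br P (br Q R)) \<oplus>\<^bsub>E\<^esub>
      signed E ((q - 1) * (p - 1)) (br Q (br R P)) \<oplus>\<^bsub>E\<^esub>
      signed E ((r - 1) * (q - 1)) (br R (br P Q)) = \<zero>\<^bsub>E\<^esub>) \<and>
    (\<forall>p q r. \<forall>P\<in>gr p. \<forall>Q\<in>gr q. \<forall>R\<in>gr r.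
      br P (Q \<otimes>\<^bsub>E\<^esub> R) =
        br P Q \<otimes>\<^bsub>E\<^esub> R \<oplus>\<^bsub>E\<^esub> signed E ((p - 1) * q) (Q \<otimes>\<^bsub>E\<^esub> br P R))"

text \<open>The brackets \<open>[x,a]\<close> and \<open>[x,y]\<close>, read back in \<open>A\<close> and \<open>G\<close> along the canonical bijections
  \<open>A \<rightarrow> \<And>\<^sup>0\<close> and \<open>G \<rightarrow> \<And>\<^sup>1\<close>.\<close>

definition induced_anchor ::
    "('a, 'm) ring_scheme \<Rightarrow> ('a, 'g, 'n) module_scheme \<Rightarrow>
      (('g list \<Rightarrow> 'a) set \<Rightarrow> ('g list \<Rightarrow> 'a) set \<Rightarrow> ('g list \<Rightarrow> 'a) set) \<Rightarrow> 'g \<Rightarrow> 'a \<Rightarrow> 'a" where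
  "induced_anchor A G br x a =
    inv_into (carrier A) (ext_scalar A G) (br (ext_vector A G x) (ext_scalar A G a))"

definition induced_bracket ::
    "('a, 'm) ring_scheme \<Rightarrow> ('a, 'g, 'n) module_scheme \<Rightarrow>
      (('g list \<Rightarrow> 'a) set \<Rightarrow> ('g list \<Rightarrow> 'a) set \<Rightarrow> ('g list \<Rightarrow> 'a) set) \<Rightarrow> 'g \<Rightarrow> 'g \<Rightarrow> 'g" where
  "induced_bracket A G br x y =
    inv_into (carrier G) (ext_vector A G) (br (ext_vector A G x) (ext_vector A G y))"

end

theory Submission
  imports Defs
begin

text \<open>
  The canonical maps \<open>A \<rightarrow> \<And>\<^sup>0\<close> and \<open>G \<rightarrow> \<And>\<^sup>1\<close> are injective: the ring homomorphism from the free
  algebra to the square-zero extension \<open>A \<oplus> G\<close>, sending a word \<open>[x]\<close> to \<open>x\<close> and every longer word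
  to \<open>0\<close>, kills the defining relations. Hence identities in \<open>A\<close> and \<open>G\<close> can be verified in
  \<open>\<And>\<^sub>A G\<close>, and each Lie--Rinehart axiom becomes an instance of a Gerstenhaber axiom whose signs are
  trivial. \<open>A\<close>-linearity of the anchor is the graded Leibniz rule for \<open>[a, b \<and> x]\<close> together
  with \<open>[a, b] \<in> \<And>\<^sup>-\<^sup>1 = 0\<close>. Graded antisymmetry only gives \<open>2 [x, x] = 0\<close>, but \<open>2\<close> is
  invertible in \<open>K\<close>.
\<close>

section \<open>The free algebra on a set\<close>

lemma free_alg_carrierI:
  assumes "\<And>w. f w \<in> carrier R" "finite {w. f w \<noteq> \<zero>\<^bsub>R\<^esub>}"
    and "\<And>w. f w \<noteq> \<zero>\<^bsub>R\<^esub> \<Longrightarrow> set w \<subseteq> carrier G"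
  shows "f \<in> carrier (free_alg R G)"
  using assms unfolding free_alg_def by (auto split: if_splits)

lemma free_alg_carrierD:
  assumes "f \<in> carrier (free_alg R G)"
  shows "f w \<in> carrier R" "finite {w. f w \<noteq> \<zero>\<^bsub>R\<^esub>}" "f w \<noteq> \<zero>\<^bsub>R\<^esub> \<Longrightarrow> set w \<subseteq> carrier G"
  using assms unfolding free_alg_def by (auto split: if_splits)

lemma free_alg_simps:
  "(f \<oplus>\<^bsub>free_alg R G\<^esub> g) w = f w \<oplus>\<^bsub>R\<^esub> g w"
  "\<zero>\<^bsub>free_alg R G\<^esub> w = \<zero>\<^bsub>R\<^esub>"
  "\<one>\<^bsub>free_alg R G\<^esub> w = (if w = [] then \<one>\<^bsub>R\<^esub> else \<zero>\<^bsub>R\<^esub>)"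
  unfolding free_alg_def by simp_all

lemma free_alg_add: "f \<oplus>\<^bsub>free_alg R G\<^esub> g = (\<lambda>w. f w \<oplus>\<^bsub>R\<^esub> g w)"
  unfolding free_alg_def by simp

lemma free_alg_one: "\<one>\<^bsub>free_alg R G\<^esub> = term_of R \<one>\<^bsub>R\<^esub> []"
  unfolding free_alg_def term_of_def by simp

context cring
begin

section \<open>The convolution product, computed word by word\<close>

lemma free_alg_mult_Nil:
  assumes "\<And>w. f w \<in> carrier R" "\<And>w. g w \<in> carrier R"
  shows "(f \<otimes>\<^bsub>free_alg R G\<^esub> g) [] = f [] \<otimes> g []"
  using assms unfolding free_alg_def by simp

text \<open>The empty prefix gives the first summand; the other cuts of \<open>x # w\<close> match
  the cuts of \<open>w\<close>, with \<open>f\<close> shifted by the letter \<open>x\<close>. This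
  recursion replaces manipulations of double sums by induction on words with \<open>f\<close> left
  arbitrary.\<close>

lemma free_alg_mult_Cons:
  assumes "\<And>w. f w \<in> carrier R" "\<And>w. g w \<in> carrier R"
  shows "(f \<otimes>\<^bsub>free_alg R G\<^esub> g) (x # w)
    = f [] \<otimes> g (x # w) \<oplus> ((\<lambda>v. f (x # v)) \<otimes>\<^bsub>free_alg R G\<^esub> g) w"
  unfolding free_alg_def by (simp add: finsum_Suc2 assms del: finsum_Suc) (simp add: assms a_comm)

lemma free_alg_mult_in_carrier:
  assumes "\<And>w. f w \<in> carrier R" "\<And>w. g w \<in> carrier R"
  shows "(f \<otimes>\<^bsub>free_alg R G\<^esub> g) w \<in> carrier R"
  unfolding free_alg_def by (simp add: assms)

lemma free_alg_mult_add_left: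
  assumes "\<And>w. f w \<in> carrier R" "\<And>w. g w \<in> carrier R" "\<And>w. h w \<in> carrier R"
  shows "((\<lambda>v. f v \<oplus> g v) \<otimes>\<^bsub>free_alg R G\<^esub> h) w
    = (f \<otimes>\<^bsub>free_alg R G\<^esub> h) w \<oplus> (g \<otimes>\<^bsub>free_alg R G\<^esub> h) w"
  unfolding free_alg_def by (simp add: assms l_distr)

lemma free_alg_mult_add_right:
  assumes "\<And>w. f w \<in> carrier R" "\<And>w. g w \<in> carrier R" "\<And>w. h w \<in> carrier R"
  shows "(h \<otimes>\<^bsub>free_alg R G\<^esub> (\<lambda>v. f v \<oplus> g v)) w
    = (h \<otimes>\<^bsub>free_alg R G\<^esub> f) w \<oplus> (h \<otimes>\<^bsub>free_alg R G\<^esub> g) w"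
  unfolding free_alg_def by (simp add: assms r_distr)

lemma free_alg_mult_scale_left:
  assumes "\<And>w. f w \<in> carrier R" "\<And>w. g w \<in> carrier R" "a \<in> carrier R"
  shows "((\<lambda>v. a \<otimes> f v) \<otimes>\<^bsub>free_alg R G\<^esub> g) w = a \<otimes> (f \<otimes>\<^bsub>free_alg R G\<^esub> g) w"
  unfolding free_alg_def by (simp add: assms m_assoc finsum_rdistr)

lemma free_alg_mult_zero_left:
  assumes "\<And>w. g w \<in> carrier R"
  shows "((\<lambda>v. \<zero>) \<otimes>\<^bsub>free_alg R G\<^esub> g) w = \<zero>"
  unfolding free_alg_def by (simp add: assms)

text \<open>By \<open>free_alg_mult_Cons\<close>, shifting the product of \<open>f\<close> and
  \<open>g\<close> by a letter gives \<open>f []\<close> times the shift of \<open>g\<close>, plus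
  the product of the shifted \<open>f\<close> with \<open>g\<close>. Linearity on the left and the
  induction hypothesis for the shifted \<open>f\<close> then close the step.\<close>

lemma free_alg_mult_assoc:
  assumes "\<And>w. f w \<in> carrier R" "\<And>w. g w \<in> carrier R" "\<And>w. h w \<in> carrier R"
  shows "((f \<otimes>\<^bsub>free_alg R G\<^esub> g) \<otimes>\<^bsub>free_alg R G\<^esub> h) w = (f \<otimes>\<^bsub>free_alg R G\<^esub> (g \<otimes>\<^bsub>free_alg R G\<^esub> h)) w"
  using assms(1)
proof (induction w arbitrary: f)
  case Nil
  then show ?case
    by (simp add: free_alg_mult_Nil free_alg_mult_in_carrier assms m_assoc)
next
  case (Cons x w)
  show ?case
    by (simp add: free_alg_mult_Nil free_alg_mult_in_carrier free_alg_mult_Cons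
        free_alg_mult_add_left free_alg_mult_scale_left Cons.IH Cons.prems assms)
       (simp add: free_alg_mult_in_carrier Cons.prems assms m_assoc r_distr a_assoc)
qed

lemma free_alg_mult_term_Nil:
  assumes "\<And>w. g w \<in> carrier R" "a \<in> carrier R"
  shows "term_of R a [] \<otimes>\<^bsub>free_alg R G\<^esub> g = (\<lambda>w. a \<otimes> g w)"
proof
  fix w
  have *: "term_of R a [] v \<in> carrier R" for v
    using assms by (simp add: term_of_def)
  show "(term_of R a [] \<otimes>\<^bsub>free_alg R G\<^esub> g) w = a \<otimes> g w"
    by (cases w) (simp_all add: free_alg_mult_Nil free_alg_mult_Cons assms *,
        simp_all add: term_of_def free_alg_mult_zero_left assms)
qed

lemma free_alg_mult_one_right:
  assumes "\<And>w. f w \<in> carrier R"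
  shows "(f \<otimes>\<^bsub>free_alg R G\<^esub> \<one>\<^bsub>free_alg R G\<^esub>) w = f w"
  using assms
  by (induction w arbitrary: f)
     (simp_all add: free_alg_mult_Nil free_alg_mult_Cons free_alg_simps)

lemma term_of_closed:
  assumes "a \<in> carrier R" "set w \<subseteq> carrier G"
  shows "term_of R a w \<in> carrier (free_alg R G)"
  by (rule free_alg_carrierI)
     (use assms in \<open>auto simp: term_of_def split: if_splits intro: finite_subset[of _ "{w}"]\<close>)

text \<open>A nonzero coefficient needs at least one cut with a nonzero summand. Hence products keep
  finite support and use only letters from \<open>carrier G\<close>.\<close>

lemma free_alg_mult_support:
  assumes "\<And>w. f w \<in> carrier R" "\<And>w. g w \<in> carrier R"
    and "(f \<otimes>\<^bsub>free_alg R G\<^esub> g) w \<noteq> \<zero>"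
  obtains u v where "w = u @ v" "f u \<noteq> \<zero>" "g v \<noteq> \<zero>"
proof -
  have "\<exists>i. f (take i w) \<otimes> g (drop i w) \<noteq> \<zero>"
  proof (rule ccontr)
    assume "\<not> ?thesis"
    then have "(f \<otimes>\<^bsub>free_alg R G\<^esub> g) w = \<zero>"
      unfolding free_alg_def by simp
    with assms show False by simp
  qed
  then obtain i where "f (take i w) \<otimes> g (drop i w) \<noteq> \<zero>" ..
  then have "f (take i w) \<noteq> \<zero>" "g (drop i w) \<noteq> \<zero>"
    using assms by auto
  then show thesis
    using that[of "take i w" "drop i w"] by simp
qed

section \<open>Ring structure of the free algebra\<close>

lemma free_alg_ring: "ring (free_alg R G)"
proof (rule ringI)
  show "abelian_group (free_alg R G)"
  proof (rule abelian_groupI)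
    fix f g assume fg: "f \<in> carrier (free_alg R G)" "g \<in> carrier (free_alg R G)"
    have "finite {w. f w \<oplus> g w \<noteq> \<zero>}"
      by (rule finite_subset[OF _ finite_UnI[OF fg[THEN free_alg_carrierD(2)]]]) auto
    moreover have "set w \<subseteq> carrier G" if "f w \<oplus> g w \<noteq> \<zero>" for w
      using that fg[THEN free_alg_carrierD(3), of w] by fastforce
    ultimately show "f \<oplus>\<^bsub>free_alg R G\<^esub> g \<in> carrier (free_alg R G)"
      by (intro free_alg_carrierI) (auto simp: free_alg_simps fg[THEN free_alg_carrierD(1)])
  next
    fix f assume f: "f \<in> carrier (free_alg R G)"
    have "{w. \<ominus> f w \<noteq> \<zero>} \<subseteq> {w. f w \<noteq> \<zero>}"
      by auto
    then have "(\<lambda>w. \<ominus> f w) \<in> carrier (free_alg R G)"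
      by (intro free_alg_carrierI) (use free_alg_carrierD[OF f] in \<open>auto intro: finite_subset\<close>)
    moreover have "(\<lambda>w. \<ominus> f w) \<oplus>\<^bsub>free_alg R G\<^esub> f = \<zero>\<^bsub>free_alg R G\<^esub>"
      by (auto simp: free_alg_simps l_neg free_alg_carrierD[OF f])
    ultimately show "\<exists>g\<in>carrier (free_alg R G). g \<oplus>\<^bsub>free_alg R G\<^esub> f = \<zero>\<^bsub>free_alg R G\<^esub>"
      by blast
  qed (auto simp: free_alg_simps free_alg_carrierD a_ac intro!: free_alg_carrierI)
  show "monoid (free_alg R G)"
  proof (rule monoidI)
    fix f g assume fg: "f \<in> carrier (free_alg R G)" "g \<in> carrier (free_alg R G)"
    note c = fg[THEN free_alg_carrierD(1)]
    have "{w. (f \<otimes>\<^bsub>free_alg R G\<^esub> g) w \<noteq> \<zero>}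
        \<subseteq> (\<lambda>(u, v). u @ v) ` ({w. f w \<noteq> \<zero>} \<times> {w. g w \<noteq> \<zero>})"
      by (auto elim!: free_alg_mult_support[OF c])
    then have "finite {w. (f \<otimes>\<^bsub>free_alg R G\<^esub> g) w \<noteq> \<zero>}"
      by (rule finite_subset) (use fg[THEN free_alg_carrierD(2)] in auto)
    moreover have "set w \<subseteq> carrier G" if "(f \<otimes>\<^bsub>free_alg R G\<^esub> g) w \<noteq> \<zero>" for w
      using free_alg_mult_support[OF c that] fg[THEN free_alg_carrierD(3)]
      by (metis set_append Un_least)
    ultimately show "f \<otimes>\<^bsub>free_alg R G\<^esub> g \<in> carrier (free_alg R G)"
      by (intro free_alg_carrierI) (auto simp: free_alg_mult_in_carrier c)
  next
    show "\<one>\<^bsub>free_alg R G\<^esub> \<in> carrier (free_alg R G)"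
      by (simp add: free_alg_one term_of_closed)
  next
    fix f assume "f \<in> carrier (free_alg R G)"
    then show "\<one>\<^bsub>free_alg R G\<^esub> \<otimes>\<^bsub>free_alg R G\<^esub> f = f"
      using free_alg_carrierD(1)[of f R G] by (simp add: free_alg_one free_alg_mult_term_Nil)
  qed (auto simp: free_alg_mult_assoc free_alg_carrierD free_alg_mult_one_right)
qed (auto simp: fun_eq_iff free_alg_add free_alg_carrierD free_alg_mult_add_left
    free_alg_mult_add_right)

text \<open>Negation in a ring record is given by a definite description, so its values cannot be
  read off by unfolding \<open>free_alg\<close>. They are recovered by cancelling \<open>g\<close>
  pointwise in (f - g) + g = f.\<close>

lemma free_alg_minus:
  assumes "f \<in> carrier (free_alg R G)" "g \<in> carrier (free_alg R G)"
  shows "(f \<ominus>\<^bsub>free_alg R G\<^esub> g) w = f w \<ominus> g w"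
proof -
  interpret F: ring "free_alg R G" by (rule free_alg_ring)
  have "(f \<ominus>\<^bsub>free_alg R G\<^esub> g) \<oplus>\<^bsub>free_alg R G\<^esub> g = f"
    using assms by algebra
  then have "(f \<ominus>\<^bsub>free_alg R G\<^esub> g) w \<oplus> g w = f w"
    using free_alg_simps(1) by metis
  moreover have "(f \<ominus>\<^bsub>free_alg R G\<^esub> g) w \<in> carrier R" "g w \<in> carrier R"
    using assms free_alg_carrierD(1)[of _ R G] by auto
  ultimately show ?thesis
    by (metis add.inv_solve_right a_closed minus_eq)
qed

end


section \<open>Degrees zero and one of the exterior algebra\<close>

abbreviation ext_ring ::
    "('a, 'm) ring_scheme \<Rightarrow> ('a, 'g, 'n) module_scheme \<Rightarrow> ('g list \<Rightarrow> 'a) set ring" where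
  "ext_ring R M \<equiv> free_alg R M Quot ext_ideal R M"

text \<open>The \<open>M\<close>-component of the map to the square-zero extension. Words of length
  other than one do not contribute, and for \<open>f\<close> in the free algebra the index set is
  finite.\<close>

definition linear_part ::
    "('a, 'm) ring_scheme \<Rightarrow> ('a, 'g, 'n) module_scheme \<Rightarrow> ('g list \<Rightarrow> 'a) \<Rightarrow> 'g" where
  "linear_part R M f = (\<Oplus>\<^bsub>M\<^esub>x\<in>{x. f [x] \<noteq> \<zero>\<^bsub>R\<^esub>}. f [x] \<odot>\<^bsub>M\<^esub> x)"

lemma finite_linear_support:
  assumes "f \<in> carrier (free_alg R G)"
  shows "finite {x. f [x] \<noteq> \<zero>\<^bsub>R\<^esub>}"
proof -
  have "finite ((\<lambda>x. [x]) -` {w. f w \<noteq> \<zero>\<^bsub>R\<^esub>})"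
    by (rule finite_vimageI[OF free_alg_carrierD(2)[OF assms]]) (simp add: inj_on_def)
  then show ?thesis by (simp add: vimage_def)
qed

lemma (in abelian_group) eq_if_minus_eq_zero:
  assumes "x \<in> carrier G" "y \<in> carrier G" "x \<ominus> y = \<zero>"
  shows "x = y"
  using assms by (metis a_minus_def add.inv_closed minus_equality minus_minus)

section \<open>Linear parts and the square-zero extension\<close>

context module
begin

text \<open>Letters with zero coefficient contribute nothing, so the support may be enlarged. This
  allows several elements to be summed over one index set.\<close>

lemma linear_part_eq:
  assumes "f \<in> carrier (free_alg R M)" "finite S" "S \<subseteq> carrier M" "{x. f [x] \<noteq> \<zero>} \<subseteq> S"
  shows "linear_part R M f = (\<Oplus>\<^bsub>M\<^esub>x\<in>S. f [x] \<odot>\<^bsub>M\<^esub> x)"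
  unfolding linear_part_def
  using assms free_alg_carrierD(1)[OF assms(1)]
  by (intro M.add.finprod_mono_neutral_cong_left) auto

lemma linear_support_carrier:
  assumes "f \<in> carrier (free_alg R M)"
  shows "{x. f [x] \<noteq> \<zero>} \<subseteq> carrier M"
  using free_alg_carrierD(3)[OF assms] by fastforce

lemma linear_part_closed:
  assumes "f \<in> carrier (free_alg R M)"
  shows "linear_part R M f \<in> carrier M"
  unfolding linear_part_def
  using linear_support_carrier[OF assms] free_alg_carrierD(1)[OF assms]
  by (intro M.finsum_closed) auto

lemma linear_part_term:
  assumes "a \<in> carrier R" "x \<in> carrier M"
  shows "linear_part R M (term_of R a [x]) = a \<odot>\<^bsub>M\<^esub> x"
  using assms by (subst linear_part_eq[of _ "{x}"])
    (auto simp: term_of_closed, auto simp: term_of_def split: if_splits)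

text \<open>\<open>h\<close> is constrained only through its one-letter coefficients, so that one
  statement covers sums, differences and products in the free algebra.\<close>

lemma linear_part_combine:
  assumes "f \<in> carrier (free_alg R M)" "g \<in> carrier (free_alg R M)" "h \<in> carrier (free_alg R M)"
    and "a \<in> carrier R" "b \<in> carrier R"
    and h: "\<And>x. h [x] = a \<otimes> f [x] \<oplus> b \<otimes> g [x]"
  shows "linear_part R M h = a \<odot>\<^bsub>M\<^esub> linear_part R M f \<oplus>\<^bsub>M\<^esub> b \<odot>\<^bsub>M\<^esub> linear_part R M g"
proof -
  \<comment> \<open>A common index set: the coefficients of \<open>h\<close> also vanish outside
    it.\<close>
  define S where "S = {x. f [x] \<noteq> \<zero>} \<union> {x. g [x] \<noteq> \<zero>}"
  have S: "finite S" "S \<subseteq> carrier M"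
    unfolding S_def using assms(1,2) finite_linear_support linear_support_carrier by auto
  have "linear_part R M h = (\<Oplus>\<^bsub>M\<^esub>x\<in>S. h [x] \<odot>\<^bsub>M\<^esub> x)"
    using assms(3-5) S by (intro linear_part_eq) (auto simp: h S_def)
  also have "\<dots> = (\<Oplus>\<^bsub>M\<^esub>x\<in>S. a \<odot>\<^bsub>M\<^esub> (f [x] \<odot>\<^bsub>M\<^esub> x) \<oplus>\<^bsub>M\<^esub> b \<odot>\<^bsub>M\<^esub> (g [x] \<odot>\<^bsub>M\<^esub> x))"
    using assms(1,2,4,5) S
    by (intro M.add.finprod_cong')
       (auto simp: h free_alg_carrierD smult_l_distr smult_assoc1 subset_iff)
  also have "\<dots> = a \<odot>\<^bsub>M\<^esub> (\<Oplus>\<^bsub>M\<^esub>x\<in>S. f [x] \<odot>\<^bsub>M\<^esub> x) \<oplus>\<^bsub>M\<^esub> b \<odot>\<^bsub>M\<^esub> (\<Oplus>\<^bsub>M\<^esub>x\<in>S. g [x] \<odot>\<^bsub>M\<^esub> x)"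
    using assms(1,2,4,5) S
    by (subst M.finsum_addf)
       (auto simp: free_alg_carrierD subset_iff finsum_smult_ldistr)
  also have "\<dots> = a \<odot>\<^bsub>M\<^esub> linear_part R M f \<oplus>\<^bsub>M\<^esub> b \<odot>\<^bsub>M\<^esub> linear_part R M g"
    using assms(1,2) S by (simp add: linear_part_eq[of _ S] S_def)
  finally show ?thesis .
qed

lemma linear_part_minus:
  assumes "f \<in> carrier (free_alg R M)" "g \<in> carrier (free_alg R M)"
  shows "linear_part R M (f \<ominus>\<^bsub>free_alg R M\<^esub> g) = linear_part R M f \<ominus>\<^bsub>M\<^esub> linear_part R M g"
proof -
  interpret F: ring "free_alg R M" by (rule free_alg_ring)
  note c = assms[THEN free_alg_carrierD(1)]
  have "linear_part R M (f \<ominus>\<^bsub>free_alg R M\<^esub> g)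
      = \<one> \<odot>\<^bsub>M\<^esub> linear_part R M f \<oplus>\<^bsub>M\<^esub> (\<ominus> \<one>) \<odot>\<^bsub>M\<^esub> linear_part R M g"
    using assms c by (intro linear_part_combine) (auto simp: free_alg_minus R.minus_eq l_minus)
  then show ?thesis
    using assms by (simp add: linear_part_closed smult_l_minus M.minus_eq)
qed

text \<open>A one-letter word can be cut only before or after its letter, which leaves two summands.
  This is the multiplication rule of the square-zero extension.\<close>

lemma linear_part_mult:
  assumes "f \<in> carrier (free_alg R M)" "g \<in> carrier (free_alg R M)"
  shows "linear_part R M (f \<otimes>\<^bsub>free_alg R M\<^esub> g)
    = f [] \<odot>\<^bsub>M\<^esub> linear_part R M g \<oplus>\<^bsub>M\<^esub> g [] \<odot>\<^bsub>M\<^esub> linear_part R M f"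
proof -
  interpret F: ring "free_alg R M" by (rule free_alg_ring)
  note c = assms[THEN free_alg_carrierD(1)]
  show ?thesis
    using assms c
    by (intro linear_part_combine) (auto simp: free_alg_mult_Cons free_alg_mult_Nil m_comm)
qed

text \<open>This ideal is the kernel of \<open>f \<mapsto> (f [], linear_part f)\<close> into the square-zero extension
  \<open>R \<oplus> M\<close>; it contains the relations, so degrees zero and one survive in the quotient.\<close>

lemma low_degree_kernel_ideal:
  "ideal {f \<in> carrier (free_alg R M). f [] = \<zero> \<and> linear_part R M f = \<zero>\<^bsub>M\<^esub>} (free_alg R M)"
    (is "ideal ?J ?F")
proof -
  interpret F: ring ?F by (rule free_alg_ring)
  have zero: "\<zero>\<^bsub>?F\<^esub> \<in> ?J"
    by (simp add: free_alg_simps linear_part_def)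
  have minus: "f \<ominus>\<^bsub>?F\<^esub> g \<in> ?J" if "f \<in> ?J" "g \<in> ?J" for f g
    using that by (simp add: free_alg_minus linear_part_minus R.minus_eq M.minus_eq)
  show ?thesis
  proof (rule idealI)
    show "ring ?F" by (rule free_alg_ring)
    show "subgroup ?J (add_monoid ?F)"
    proof (rule F.add.subgroupI)
      show uminus: "\<ominus>\<^bsub>?F\<^esub> f \<in> ?J" if "f \<in> ?J" for f
        using minus[OF zero that] that by (simp add: F.minus_eq)
      show "f \<oplus>\<^bsub>?F\<^esub> g \<in> ?J" if "f \<in> ?J" "g \<in> ?J" for f g
        using minus[OF that(1) uminus[OF that(2)]] that by (simp add: F.minus_eq)
    qed (use zero in auto)
  \<comment> \<open>Absorption on both sides: if one factor lies in the kernel, each summand of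
    \<open>linear_part_mult\<close> contains its constant coefficient or its linear part, both
    zero.\<close>
  qed (auto simp: linear_part_mult linear_part_closed free_alg_mult_Nil free_alg_carrierD)
qed

text \<open>No relation has a constant coefficient. Evaluating one-letter words in \<open>M\<close>
  turns the first two families into differences of equal vectors, while \<open>[x, x]\<close> has no
  one-letter part at all.\<close>

lemma ext_relations_subset:
  "ext_relations R M
    \<subseteq> {f \<in> carrier (free_alg R M). f [] = \<zero> \<and> linear_part R M f = \<zero>\<^bsub>M\<^esub>}" (is "_ \<subseteq> ?J")
proof -
  interpret F: ring "free_alg R M" by (rule free_alg_ring)
  have t: "term_of R a [x] \<in> carrier (free_alg R M)" if "a \<in> carrier R" "x \<in> carrier M" for a x
    using that by (simp add: term_of_closed)
  have n: "term_of R a [x] [] = \<zero>" for a x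
    by (simp add: term_of_def)
  have "term_of R \<one> [x, x] \<in> ?J" if "x \<in> carrier M" for x
  proof -
    have "linear_part R M (term_of R \<one> [x, x]) = \<zero>\<^bsub>M\<^esub>"
      by (simp add: linear_part_def term_of_def)
    then show ?thesis
      using that by (simp add: term_of_closed) (simp add: term_of_def)
  qed
  moreover have "term_of R \<one> [a \<odot>\<^bsub>M\<^esub> x] \<ominus>\<^bsub>free_alg R M\<^esub> term_of R a [x] \<in> ?J"
    if "a \<in> carrier R" "x \<in> carrier M" for a x
    using that by (simp add: t n free_alg_minus linear_part_minus linear_part_term R.minus_eq
        M.minus_eq M.r_neg)
  moreover have "term_of R \<one> [x \<oplus>\<^bsub>M\<^esub> y] \<ominus>\<^bsub>free_alg R M\<^esub>
      (term_of R \<one> [x] \<oplus>\<^bsub>free_alg R M\<^esub> term_of R \<one> [y]) \<in> ?J"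
    if "x \<in> carrier M" "y \<in> carrier M" for x y
  proof -
    have "linear_part R M (term_of R \<one> [x] \<oplus>\<^bsub>free_alg R M\<^esub> term_of R \<one> [y])
      = \<one> \<odot>\<^bsub>M\<^esub> linear_part R M (term_of R \<one> [x]) \<oplus>\<^bsub>M\<^esub> \<one> \<odot>\<^bsub>M\<^esub> linear_part R M (term_of R \<one> [y])"
      using that by (intro linear_part_combine) (auto simp: t free_alg_simps free_alg_carrierD[OF t])
    then show ?thesis
      using that by (simp add: t n free_alg_simps free_alg_minus linear_part_minus linear_part_term
          R.minus_eq M.minus_eq M.r_neg)
  qed
  ultimately show ?thesis
    unfolding ext_relations_def by blast
qed

section \<open>The quotient and its invariants in low degree\<close>

lemma ext_ideal_ideal: "ideal (ext_ideal R M) (free_alg R M)"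
  unfolding ext_ideal_def
  by (intro ring.genideal_ideal free_alg_ring) (use ext_relations_subset in auto)

text \<open>The generated ideal is the least one containing the relations, hence it lies inside the
  kernel ideal.\<close>

lemma ext_ideal_low_degree:
  assumes "f \<in> ext_ideal R M"
  shows "f [] = \<zero>" "linear_part R M f = \<zero>\<^bsub>M\<^esub>"
  using ring.genideal_minimal[OF free_alg_ring low_degree_kernel_ideal ext_relations_subset] assms
  by (auto simp: ext_ideal_def)

lemma ext_class_hom: "ring_hom_ring (free_alg R M) (ext_ring R M) (ext_class R M)"
  using ideal.rcos_ring_hom_ring[OF ext_ideal_ideal] by (simp add: ext_class_def[abs_def])

lemma ext_class_eqI:
  assumes "f \<ominus>\<^bsub>free_alg R M\<^esub> g \<in> ext_relations R M"
    and "f \<in> carrier (free_alg R M)" "g \<in> carrier (free_alg R M)"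
  shows "ext_class R M f = ext_class R M g"
proof -
  interpret F: ring "free_alg R M" by (rule free_alg_ring)
  have "ext_relations R M \<subseteq> ext_ideal R M"
    unfolding ext_ideal_def using ext_relations_subset by (intro F.genideal_self) auto
  then show ?thesis
    using F.quotient_eq_iff_same_a_r_cos[OF ext_ideal_ideal assms(2,3)] assms(1)
    by (auto simp: ext_class_def)
qed

text \<open>The difference of two representatives lies in \<open>ext_ideal\<close>, so constant
  coefficient and linear part descend to classes. They provide left inverses of the two canonical
  maps.\<close>

lemma ext_class_eqD:
  assumes "ext_class R M f = ext_class R M g"
    and "f \<in> carrier (free_alg R M)" "g \<in> carrier (free_alg R M)"
  shows "f [] = g []" "linear_part R M f = linear_part R M g"
proof -
  interpret F: ring "free_alg R M" by (rule free_alg_ring)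
  have *: "f \<ominus>\<^bsub>free_alg R M\<^esub> g \<in> ext_ideal R M"
    using F.quotient_eq_iff_same_a_r_cos[OF ext_ideal_ideal assms(2,3)] assms(1)
    by (auto simp: ext_class_def)
  have "f [] \<ominus> g [] = \<zero>"
    using ext_ideal_low_degree(1)[OF *] by (simp add: free_alg_minus assms(2,3))
  then show "f [] = g []"
    by (rule R.eq_if_minus_eq_zero[rotated 2]) (simp_all add: free_alg_carrierD[OF assms(2)]
        free_alg_carrierD[OF assms(3)])
  have "linear_part R M f \<ominus>\<^bsub>M\<^esub> linear_part R M g = \<zero>\<^bsub>M\<^esub>"
    using ext_ideal_low_degree(2)[OF *] by (simp add: linear_part_minus assms(2,3))
  then show "linear_part R M f = linear_part R M g"
    by (rule M.eq_if_minus_eq_zero[rotated 2]) (simp_all add: linear_part_closed assms(2,3))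
qed

section \<open>The canonical maps from scalars and vectors\<close>

lemma ext_scalar_closed: "a \<in> carrier R \<Longrightarrow> ext_scalar R M a \<in> carrier (ext_ring R M)"
  unfolding ext_scalar_def
  by (intro ring_hom_closed[OF ring_hom_ring.homh[OF ext_class_hom]] term_of_closed) auto

lemma ext_vector_closed: "x \<in> carrier M \<Longrightarrow> ext_vector R M x \<in> carrier (ext_ring R M)"
  unfolding ext_vector_def
  by (intro ring_hom_closed[OF ring_hom_ring.homh[OF ext_class_hom]] term_of_closed) auto

lemma ext_scalar_inj: "inj_on (ext_scalar R M) (carrier R)"
proof (rule inj_onI)
  fix a b assume *: "a \<in> carrier R" "b \<in> carrier R" "ext_scalar R M a = ext_scalar R M b"
  from ext_class_eqD(1)[OF *(3)[unfolded ext_scalar_def]] *(1,2) show "a = b"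
    by (simp add: term_of_closed) (simp add: term_of_def)
qed

lemma ext_vector_inj: "inj_on (ext_vector R M) (carrier M)"
proof (rule inj_onI)
  fix x y assume *: "x \<in> carrier M" "y \<in> carrier M" "ext_vector R M x = ext_vector R M y"
  then have "linear_part R M (term_of R \<one> [x]) = linear_part R M (term_of R \<one> [y])"
    unfolding ext_vector_def
    by (intro ext_class_eqD(2)[of "term_of R \<one> [x]" "term_of R \<one> [y]"] term_of_closed) auto
  with * show "x = y" by (simp add: linear_part_term)
qed

lemma ext_scalar_add:
  assumes "a \<in> carrier R" "b \<in> carrier R"
  shows "ext_scalar R M (a \<oplus> b) = ext_scalar R M a \<oplus>\<^bsub>ext_ring R M\<^esub> ext_scalar R M b"
proof -
  have "term_of R (a \<oplus> b) [] = term_of R a [] \<oplus>\<^bsub>free_alg R M\<^esub> term_of R b []"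
    using assms by (auto simp: term_of_def free_alg_simps fun_eq_iff)
  then show ?thesis
    using assms by (simp add: ext_scalar_def ring_hom_add[OF ring_hom_ring.homh[OF ext_class_hom]]
        term_of_closed)
qed

text \<open>Scaling all coefficients is multiplication by a constant in the free algebra, and taking
  classes is multiplicative.\<close>

lemma ext_class_scale:
  assumes "a \<in> carrier R" "f \<in> carrier (free_alg R M)"
  shows "ext_class R M (\<lambda>w. a \<otimes> f w) = ext_scalar R M a \<otimes>\<^bsub>ext_ring R M\<^esub> ext_class R M f"
proof -
  have "(\<lambda>w. a \<otimes> f w) = term_of R a [] \<otimes>\<^bsub>free_alg R M\<^esub> f"
    using assms by (subst free_alg_mult_term_Nil) (auto simp: free_alg_carrierD)
  then show ?thesis
    using assms by (simp add: ext_scalar_def ring_hom_mult[OF ring_hom_ring.homh[OF ext_class_hom]]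
        term_of_closed)
qed

lemma ext_scalar_mult:
  assumes "a \<in> carrier R" "b \<in> carrier R"
  shows "ext_scalar R M (a \<otimes> b) = ext_scalar R M a \<otimes>\<^bsub>ext_ring R M\<^esub> ext_scalar R M b"
proof -
  have "ext_scalar R M (a \<otimes> b) = ext_class R M (\<lambda>w. a \<otimes> term_of R b [] w)"
    unfolding ext_scalar_def
    by (rule arg_cong[where f = "ext_class R M"]) (use assms in \<open>auto simp: term_of_def\<close>)
  then show ?thesis
    using assms by (simp add: ext_class_scale term_of_closed ext_scalar_def)
qed

text \<open>The second family of relations moves a coefficient into the letter.\<close>

lemma ext_class_term:
  assumes "a \<in> carrier R" "x \<in> carrier M"
  shows "ext_class R M (term_of R a [x]) = ext_vector R M (a \<odot>\<^bsub>M\<^esub> x)"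
  unfolding ext_vector_def
  using assms
  by (intro ext_class_eqI[symmetric]) (auto simp: term_of_closed ext_relations_def)

lemma ext_vector_add:
  assumes "x \<in> carrier M" "y \<in> carrier M"
  shows "ext_vector R M (x \<oplus>\<^bsub>M\<^esub> y) = ext_vector R M x \<oplus>\<^bsub>ext_ring R M\<^esub> ext_vector R M y"
proof -
  interpret F: ring "free_alg R M" by (rule free_alg_ring)
  have "ext_vector R M (x \<oplus>\<^bsub>M\<^esub> y)
      = ext_class R M (term_of R \<one> [x] \<oplus>\<^bsub>free_alg R M\<^esub> term_of R \<one> [y])"
    unfolding ext_vector_def
    using assms by (intro ext_class_eqI F.a_closed) (auto simp: term_of_closed ext_relations_def)
  then show ?thesis
    using assms by (simp add: ext_vector_def ring_hom_add[OF ring_hom_ring.homh[OF ext_class_hom]]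
        term_of_closed)
qed

lemma ext_vector_smult:
  assumes "a \<in> carrier R" "x \<in> carrier M"
  shows "ext_vector R M (a \<odot>\<^bsub>M\<^esub> x) = ext_scalar R M a \<otimes>\<^bsub>ext_ring R M\<^esub> ext_vector R M x"
proof -
  have "term_of R a [x] = (\<lambda>w. a \<otimes> term_of R \<one> [x] w)"
    using assms by (auto simp: term_of_def)
  then have "ext_class R M (term_of R a [x]) = ext_scalar R M a \<otimes>\<^bsub>ext_ring R M\<^esub> ext_vector R M x"
    using assms by (simp add: ext_class_scale term_of_closed ext_vector_def)
  then show ?thesis
    using assms by (simp add: ext_class_term)
qed

lemma ext_ring_ring: "ring (ext_ring R M)"
  by (rule ideal.quotient_is_ring[OF ext_ideal_ideal])

lemma ext_vector_zero: "ext_vector R M \<zero>\<^bsub>M\<^esub> = \<zero>\<^bsub>ext_ring R M\<^esub>"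
proof -
  interpret E: ring "ext_ring R M" by (rule ext_ring_ring)
  show ?thesis
    using ext_vector_add[of "\<zero>\<^bsub>M\<^esub>" "\<zero>\<^bsub>M\<^esub>"] ext_vector_closed[of "\<zero>\<^bsub>M\<^esub>"] by simp
qed

section \<open>Exterior powers of degree at most one\<close>

lemma exterior_power_0: "exterior_power R M 0 = ext_scalar R M ` carrier R"
proof
  show "exterior_power R M 0 \<subseteq> ext_scalar R M ` carrier R"
  proof
    fix P assume "P \<in> exterior_power R M 0"
    then obtain f where f: "f \<in> carrier (free_alg R M)" "\<And>w. f w \<noteq> \<zero> \<Longrightarrow> w = []"
      and P: "P = ext_class R M f"
      by (auto simp: exterior_power_def)
    have "f = term_of R (f []) []"
      using f(2) by (auto simp: term_of_def fun_eq_iff)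
    then have "P = ext_scalar R M (f [])"
      by (simp add: ext_scalar_def P)
    then show "P \<in> ext_scalar R M ` carrier R"
      using free_alg_carrierD(1)[OF f(1)] by blast
  qed
  show "ext_scalar R M ` carrier R \<subseteq> exterior_power R M 0"
    by (auto simp: exterior_power_def ext_scalar_def term_of_closed intro!: imageI)
       (simp add: term_of_def split: if_splits)
qed

text \<open>A combination of letters collapses to the class of a single letter: induction on the
  support removes one letter, absorbs its coefficient into it and adds it to the vector obtained for
  the rest.\<close>

lemma ext_class_linear:
  assumes "finite S" "f \<in> carrier (free_alg R M)" "\<And>w. f w \<noteq> \<zero> \<Longrightarrow> w \<in> (\<lambda>x. [x]) ` S"
  shows "ext_class R M f \<in> ext_vector R M ` carrier M"
  using assms
proof (induction S arbitrary: f)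
  case empty
  interpret F: ring "free_alg R M" by (rule free_alg_ring)
  \<comment> \<open>The zero function is written as a one-letter term so that
    \<open>ext_class_term\<close> exhibits its class as a vector.\<close>
  have "f = term_of R \<zero> [\<zero>\<^bsub>M\<^esub>]"
    using empty by (auto simp: term_of_def fun_eq_iff)
  then have "ext_class R M f = ext_vector R M (\<zero> \<odot>\<^bsub>M\<^esub> \<zero>\<^bsub>M\<^esub>)"
    by (simp add: ext_class_term del: smult_l_null smult_r_null)
  then show ?case by simp
next
  case (insert x S)
  show ?case
  proof (cases "f [x] = \<zero>")
    case True
    then have "w \<in> (\<lambda>x. [x]) ` S" if "f w \<noteq> \<zero>" for w
      using insert.prems(2)[OF that] that by auto
    then show ?thesis
      using insert.IH insert.prems(1) by blast
  next
    case False
    \<comment> \<open>Deleting the coefficient at \<open>[x]\<close> leaves an element supported on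
      the letters in \<open>S\<close>.\<close>
    define g where "g = f([x] := \<zero>)"
    have x: "x \<in> carrier M" and fx: "f [x] \<in> carrier R"
      using free_alg_carrierD(1,3)[OF insert.prems(1), of "[x]"] False by auto
    have "{w. g w \<noteq> \<zero>} \<subseteq> {w. f w \<noteq> \<zero>}"
      by (auto simp: g_def)
    then have g: "g \<in> carrier (free_alg R M)"
      using free_alg_carrierD[OF insert.prems(1)]
      by (intro free_alg_carrierI) (auto simp: g_def intro: finite_subset split: if_splits)
    have "w \<in> (\<lambda>x. [x]) ` S" if "g w \<noteq> \<zero>" for w
      using insert.prems(2)[of w] that by (auto simp: g_def split: if_splits)
    with g obtain y where y: "y \<in> carrier M" "ext_class R M g = ext_vector R M y"
      using insert.IH by blast
    have "f = g \<oplus>\<^bsub>free_alg R M\<^esub> term_of R (f [x]) [x]"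
      using free_alg_carrierD(1)[OF insert.prems(1)]
      by (auto simp: g_def term_of_def free_alg_simps)
    then have "ext_class R M f = ext_class R M (g \<oplus>\<^bsub>free_alg R M\<^esub> term_of R (f [x]) [x])"
      by (rule arg_cong)
    also have "\<dots> = ext_class R M g \<oplus>\<^bsub>ext_ring R M\<^esub> ext_class R M (term_of R (f [x]) [x])"
      using x fx by (intro ring_hom_add[OF ring_hom_ring.homh[OF ext_class_hom] g] term_of_closed)
        auto
    also have "\<dots> = ext_vector R M (y \<oplus>\<^bsub>M\<^esub> f [x] \<odot>\<^bsub>M\<^esub> x)"
      using x fx y by (simp add: ext_class_term ext_vector_add)
    finally show ?thesis
      using x fx y by auto
  qed
qed

lemma exterior_power_1: "exterior_power R M 1 = ext_vector R M ` carrier M"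
proof
  show "exterior_power R M 1 \<subseteq> ext_vector R M ` carrier M"
  proof
    fix P assume "P \<in> exterior_power R M 1"
    then obtain f where f: "f \<in> carrier (free_alg R M)" "\<And>w. f w \<noteq> \<zero> \<Longrightarrow> length w = 1"
      and P: "P = ext_class R M f"
      by (auto simp: exterior_power_def)
    have "w \<in> (\<lambda>x. [x]) ` {x. f [x] \<noteq> \<zero>}" if "f w \<noteq> \<zero>" for w
      using f(2)[OF that] that by (auto simp: length_Suc_conv)
    then show "P \<in> ext_vector R M ` carrier M"
      unfolding P by (intro ext_class_linear[OF finite_linear_support[OF f(1)] f(1)])
  qed
  show "ext_vector R M ` carrier M \<subseteq> exterior_power R M 1"
    by (auto simp: exterior_power_def ext_vector_def term_of_closed intro!: imageI)
       (simp add: term_of_def split: if_splits)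
qed

text \<open>No word has negative length, so every representative is zero. The case p = -1 makes
  brackets of two scalars vanish.\<close>

lemma exterior_power_negative:
  assumes "p < 0"
  shows "exterior_power R M p \<subseteq> {\<zero>\<^bsub>ext_ring R M\<^esub>}"
proof
  fix P assume "P \<in> exterior_power R M p"
  then obtain f where f: "\<And>w. f w \<noteq> \<zero> \<Longrightarrow> int (length w) = p" and P: "P = ext_class R M f"
    by (auto simp: exterior_power_def)
  have "f = \<zero>\<^bsub>free_alg R M\<^esub>"
    using f assms by (auto simp: fun_eq_iff free_alg_simps)
  then show "P \<in> {\<zero>\<^bsub>ext_ring R M\<^esub>}"
    using ring_hom_zero[OF ring_hom_ring.homh[OF ext_class_hom] free_alg_ring ext_ring_ring]
    by (simp add: P)
qed

end


section \<open>The induced Lie--Rinehart structure\<close>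

lemma restrict_scalars_simps:
  "carrier (restrict_scalars K A M) = carrier M"
  "add (restrict_scalars K A M) = add M"
  "zero (restrict_scalars K A M) = zero M"
  "mult (restrict_scalars K A M) = mult M"
  "smult (restrict_scalars K A M) k x = (k \<odot>\<^bsub>A\<^esub> \<one>\<^bsub>A\<^esub>) \<odot>\<^bsub>M\<^esub> x"
  "a_inv (restrict_scalars K A M) x = a_inv M x"
  by (simp_all add: restrict_scalars_def a_inv_def m_inv_def)

text \<open>Together with \<open>restrict_scalars_simps\<close> this translates the bracket axioms
  into the quotient ring. Negation transfers too, since it is determined by carrier, addition and
  zero.\<close>

lemma exterior_algebra_simps:
  "carrier (exterior_algebra A G) = carrier (ext_ring A G)"
  "add (exterior_algebra A G) = add (ext_ring A G)"
  "zero (exterior_algebra A G) = zero (ext_ring A G)"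
  "mult (exterior_algebra A G) = mult (ext_ring A G)"
  "smult (exterior_algebra A G) a P = ext_scalar A G a \<otimes>\<^bsub>ext_ring A G\<^esub> P"
  "a_inv (exterior_algebra A G) P = a_inv (ext_ring A G) P"
  by (simp_all add: exterior_algebra_def ring.defs module.defs a_inv_def m_inv_def)

text \<open>\<open>R\<close> acts on \<open>N\<close> through the ring homomorphism sending k to k
  times the unit of \<open>M\<close>, so the module laws are inherited from the action of
  \<open>M\<close>.\<close>

lemma (in algebra) restrict_scalars_module:
  assumes "module M N"
  shows "module R (restrict_scalars R M N)"
proof -
  interpret N: module M N by (rule assms)
  show ?thesis
  proof (rule moduleI)
    show "cring R" by (rule R_cring)
    show "abelian_group (restrict_scalars R M N)"
      by (rule abelian_groupI)
         (auto simp: restrict_scalars_simps N.M.a_ac N.M.l_neg intro!: bexI[of _ "\<ominus>\<^bsub>N\<^esub> x" for x])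
  next
    fix a b x assume "a \<in> carrier R" "b \<in> carrier R" "x \<in> carrier (restrict_scalars R M N)"
    then show "(a \<oplus> b) \<odot>\<^bsub>restrict_scalars R M N\<^esub> x
        = a \<odot>\<^bsub>restrict_scalars R M N\<^esub> x \<oplus>\<^bsub>restrict_scalars R M N\<^esub> b \<odot>\<^bsub>restrict_scalars R M N\<^esub> x"
      "(a \<otimes> b) \<odot>\<^bsub>restrict_scalars R M N\<^esub> x
        = a \<odot>\<^bsub>restrict_scalars R M N\<^esub> (b \<odot>\<^bsub>restrict_scalars R M N\<^esub> x)"
      by (simp_all add: restrict_scalars_simps smult_l_distr N.smult_l_distr smult_assoc1 smult_assoc2
          flip: N.smult_assoc1)
  qed (simp_all add: restrict_scalars_simps N.smult_r_distr)
qed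

lemma (in module) double_eq_zero:
  assumes "field R" "\<one> \<oplus> \<one> \<noteq> \<zero>" "x \<in> carrier M" "x \<oplus>\<^bsub>M\<^esub> x = \<zero>\<^bsub>M\<^esub>"
  shows "x = \<zero>\<^bsub>M\<^esub>"
proof -
  have u: "\<one> \<oplus> \<one> \<in> Units R"
    using field.field_Units[OF assms(1)] assms(2) by simp
  have "x = (inv (\<one> \<oplus> \<one>) \<otimes> (\<one> \<oplus> \<one>)) \<odot>\<^bsub>M\<^esub> x"
    using u assms(3) by simp
  also have "\<dots> = inv (\<one> \<oplus> \<one>) \<odot>\<^bsub>M\<^esub> (x \<oplus>\<^bsub>M\<^esub> x)"
    using u assms(3) by (simp add: smult_assoc1 smult_l_distr del: R.Units_l_inv)
  also have "\<dots> = \<zero>\<^bsub>M\<^esub>"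
    using u assms(4) by simp
  finally show ?thesis .
qed

section \<open>Gerstenhaber axioms in degrees zero and one\<close>

locale gerstenhaber_exterior = algebra K A + G: module A G
  for K (structure) and A (structure) and G (structure) +
  fixes br
  assumes gerstenhaber: "gerstenhaber_bracket K (restrict_scalars K A (exterior_algebra A G))
    (exterior_power A G) br"
begin

abbreviation E where "E \<equiv> ext_ring A G"
abbreviation sc where "sc \<equiv> ext_scalar A G"
abbreviation vec where "vec \<equiv> ext_vector A G"
abbreviation anchor where "anchor \<equiv> induced_anchor A G br"
abbreviation lb where "lb \<equiv> induced_bracket A G br"

sublocale E: ring E
  by (rule G.ext_ring_ring)

lemma sc_power: "a \<in> carrier A \<Longrightarrow> sc a \<in> exterior_power A G 0"
  by (simp add: G.exterior_power_0)

lemma vec_power: "x \<in> carrier G \<Longrightarrow> vec x \<in> exterior_power A G 1"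
  by (simp add: G.exterior_power_1)

lemmas bracket_axioms = gerstenhaber[unfolded gerstenhaber_bracket_def bilinear_on_def
    restrict_scalars_simps exterior_algebra_simps]

lemmas br_bilinear = bracket_axioms[THEN conjunct1]
lemmas br_graded = bracket_axioms[THEN conjunct2]

lemma br_closed: "P \<in> carrier E \<Longrightarrow> Q \<in> carrier E \<Longrightarrow> br P Q \<in> carrier E"
  by (rule funcset_mem[OF funcset_mem[OF br_bilinear[THEN conjunct1]]])

lemmas br_add =
  br_bilinear[THEN conjunct2, THEN conjunct1, rule_format, THEN conjunct1]
  br_bilinear[THEN conjunct2, THEN conjunct1, rule_format, THEN conjunct2]

lemmas br_scale =
  br_bilinear[THEN conjunct2, THEN conjunct2, rule_format, THEN conjunct1]
  br_bilinear[THEN conjunct2, THEN conjunct2, rule_format, THEN conjunct2]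

lemmas br_power = br_graded[THEN conjunct1, rule_format]

text \<open>Only the even case is recorded, here and in the two lemmas that follow: in each later
  application the sign exponents are 0.\<close>

lemma br_antisym:
  assumes "P \<in> exterior_power A G p" "Q \<in> exterior_power A G q" "even ((p - 1) * (q - 1))"
  shows "br P Q = \<ominus>\<^bsub>E\<^esub> br Q P"
proof -
  \<comment> \<open>\<open>signed\<close> takes the whole structure as an argument, so it still
    refers to the restricted exterior algebra; the even exponent removes it.\<close>
  have "br P Q = \<ominus>\<^bsub>E\<^esub> signed (restrict_scalars K A (exterior_algebra A G)) ((p - 1) * (q - 1)) (br Q P)"
    using assms by (intro br_graded[THEN conjunct2, THEN conjunct1, rule_format])
  with assms(3) show ?thesis by (simp add: signed_def)
qed

lemma br_jacobi:
  assumes "P \<in> exterior_power A G p" "Q \<in> exterior_power A G q" "R \<in> exterior_power A G r"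
    and "even ((p - 1) * (r - 1))" "even ((q - 1) * (p - 1))" "even ((r - 1) * (q - 1))"
  shows "br P (br Q R) \<oplus>\<^bsub>E\<^esub> br Q (br R P) \<oplus>\<^bsub>E\<^esub> br R (br P Q) = \<zero>\<^bsub>E\<^esub>"
proof -
  let ?E = "restrict_scalars K A (exterior_algebra A G)"
  have "signed ?E ((p - 1) * (r - 1)) (br P (br Q R)) \<oplus>\<^bsub>E\<^esub>
      signed ?E ((q - 1) * (p - 1)) (br Q (br R P)) \<oplus>\<^bsub>E\<^esub>
      signed ?E ((r - 1) * (q - 1)) (br R (br P Q)) = \<zero>\<^bsub>E\<^esub>"
    using assms by (intro br_graded[THEN conjunct2, THEN conjunct2, THEN conjunct1, rule_format])
  with assms(4-) show ?thesis by (simp only: signed_def if_True)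
qed

lemma br_leibniz:
  assumes "P \<in> exterior_power A G p" "Q \<in> exterior_power A G q" "R \<in> exterior_power A G r"
    and "even ((p - 1) * q)"
  shows "br P (Q \<otimes>\<^bsub>E\<^esub> R) = br P Q \<otimes>\<^bsub>E\<^esub> R \<oplus>\<^bsub>E\<^esub> Q \<otimes>\<^bsub>E\<^esub> br P R"
proof -
  have "br P (Q \<otimes>\<^bsub>E\<^esub> R) = br P Q \<otimes>\<^bsub>E\<^esub> R \<oplus>\<^bsub>E\<^esub>
      signed (restrict_scalars K A (exterior_algebra A G)) ((p - 1) * q) (Q \<otimes>\<^bsub>E\<^esub> br P R)"
    using assms by (intro br_graded[THEN conjunct2, THEN conjunct2, THEN conjunct2, rule_format])
  with assms(4) show ?thesis by (simp only: signed_def if_True)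
qed

text \<open>Additivity forces [P, 0] = 0 by cancellation, and then [P, -Q] is the additive inverse
  of [P, Q].\<close>

lemma br_minus:
  assumes "P \<in> carrier E" "Q \<in> carrier E"
  shows "br P (\<ominus>\<^bsub>E\<^esub> Q) = \<ominus>\<^bsub>E\<^esub> br P Q"
proof -
  have "br P \<zero>\<^bsub>E\<^esub> = br P \<zero>\<^bsub>E\<^esub> \<oplus>\<^bsub>E\<^esub> br P \<zero>\<^bsub>E\<^esub>"
    using br_add(2)[of "\<zero>\<^bsub>E\<^esub>" "\<zero>\<^bsub>E\<^esub>" P] assms by simp
  then have "br P \<zero>\<^bsub>E\<^esub> = \<zero>\<^bsub>E\<^esub>"
    using br_closed[of P "\<zero>\<^bsub>E\<^esub>"] assms by simp
  then have "br P (\<ominus>\<^bsub>E\<^esub> Q) \<oplus>\<^bsub>E\<^esub> br P Q = \<zero>\<^bsub>E\<^esub>"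
    using br_add(2)[of "\<ominus>\<^bsub>E\<^esub> Q" Q P] assms by (simp add: E.l_neg)
  then show ?thesis
    using assms by (intro E.minus_equality[symmetric]) (auto simp: br_closed)
qed

text \<open>The bracket has degree 1 + 0 - 1 = 0, so it lies in the range of \<open>sc\<close> and
  \<open>inv_into\<close> returns a genuine preimage.\<close>

lemma anchor:
  assumes "x \<in> carrier G" "a \<in> carrier A"
  shows "anchor x a \<in> carrier A" "sc (anchor x a) = br (vec x) (sc a)"
proof -
  have "br (vec x) (sc a) \<in> sc ` carrier A"
    using br_power[OF vec_power sc_power] assms by (simp add: G.exterior_power_0)
  then show "anchor x a \<in> carrier A" "sc (anchor x a) = br (vec x) (sc a)"
    unfolding induced_anchor_def by (rule inv_into_into, rule f_inv_into_f)
qed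

text \<open>Likewise 1 + 1 - 1 = 1 puts the bracket of two vectors in the range of
  \<open>vec\<close>.\<close>

lemma lb:
  assumes "x \<in> carrier G" "y \<in> carrier G"
  shows "lb x y \<in> carrier G" "vec (lb x y) = br (vec x) (vec y)"
proof -
  have "br (vec x) (vec y) \<in> vec ` carrier G"
    using br_power[OF vec_power vec_power] assms by (simp add: G.exterior_power_1)
  then show "lb x y \<in> carrier G" "vec (lb x y) = br (vec x) (vec y)"
    unfolding induced_bracket_def by (rule inv_into_into, rule f_inv_into_f)
qed

lemma br_sc_vec:
  assumes "x \<in> carrier G" "a \<in> carrier A"
  shows "br (sc a) (vec x) = \<ominus>\<^bsub>E\<^esub> br (vec x) (sc a)"
  using br_antisym[OF sc_power vec_power] assms by simp

lemma br_sc_sc: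
  assumes "a \<in> carrier A" "b \<in> carrier A"
  shows "br (sc a) (sc b) = \<zero>\<^bsub>E\<^esub>"
  using br_power[OF sc_power[OF assms(1)] sc_power[OF assms(2)]] G.exterior_power_negative[of "-1"]
  by auto

text \<open>Rewrite rules that push \<open>sc\<close> and \<open>vec\<close> through the operations,
  turning an identity in \<open>A\<close> or \<open>G\<close> into one in \<open>E\<close>.\<close>

lemmas to_E = anchor lb br_closed G.ext_scalar_closed G.ext_vector_closed G.ext_scalar_add
  G.ext_scalar_mult G.ext_vector_add G.ext_vector_smult br_add br_scale

lemma sc_eqI: "sc a = sc b \<Longrightarrow> a \<in> carrier A \<Longrightarrow> b \<in> carrier A \<Longrightarrow> a = b"
  using G.ext_scalar_inj by (rule inj_onD)

lemma vec_eqI: "vec x = vec y \<Longrightarrow> x \<in> carrier G \<Longrightarrow> y \<in> carrier G \<Longrightarrow> x = y"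
  using G.ext_vector_inj by (rule inj_onD)

section \<open>The anchor\<close>

lemma anchor_Der:
  assumes x: "x \<in> carrier G"
  shows "anchor x \<in> Der K A"
proof -
  have "anchor x (a \<oplus>\<^bsub>A\<^esub> b) = anchor x a \<oplus>\<^bsub>A\<^esub> anchor x b"
    if "a \<in> carrier A" "b \<in> carrier A" for a b
    by (rule sc_eqI) (use x that in \<open>simp_all add: to_E\<close>)
  moreover have "anchor x (k \<odot>\<^bsub>A\<^esub> a) = k \<odot>\<^bsub>A\<^esub> anchor x a"
    if "k \<in> carrier K" "a \<in> carrier A" for k a
  proof -
    \<comment> \<open>\<open>K\<close> acts on \<open>E\<close> through scalars of \<open>A\<close>,
      so k is replaced by k times the unit; then \<open>br_scale\<close> applies.\<close>
    have *: "k \<odot>\<^bsub>A\<^esub> b = (k \<odot>\<^bsub>A\<^esub> \<one>\<^bsub>A\<^esub>) \<otimes>\<^bsub>A\<^esub> b" if "b \<in> carrier A" for b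
      using that \<open>k \<in> carrier K\<close> by (simp add: smult_assoc2)
    have "anchor x ((k \<odot>\<^bsub>A\<^esub> \<one>\<^bsub>A\<^esub>) \<otimes>\<^bsub>A\<^esub> a) = (k \<odot>\<^bsub>A\<^esub> \<one>\<^bsub>A\<^esub>) \<otimes>\<^bsub>A\<^esub> anchor x a"
      by (rule sc_eqI) (use x that in \<open>simp_all add: to_E\<close>)
    then show ?thesis
      using that x by (simp add: *[symmetric] anchor)
  qed
  moreover have "anchor x (a \<otimes>\<^bsub>A\<^esub> b) = anchor x a \<otimes>\<^bsub>A\<^esub> b \<oplus>\<^bsub>A\<^esub> a \<otimes>\<^bsub>A\<^esub> anchor x b"
    if "a \<in> carrier A" "b \<in> carrier A" for a b
    by (rule sc_eqI)
       (use x that in \<open>simp_all add: to_E br_leibniz[OF vec_power sc_power sc_power]\<close>)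
  ultimately show ?thesis
    using x by (auto simp: Der_def anchor)
qed

lemma anchor_add:
  assumes "x \<in> carrier G" "y \<in> carrier G" "a \<in> carrier A"
  shows "anchor (x \<oplus>\<^bsub>G\<^esub> y) a = anchor x a \<oplus>\<^bsub>A\<^esub> anchor y a"
  by (rule sc_eqI) (use assms in \<open>simp_all add: to_E\<close>)

lemma anchor_smult:
  assumes "b \<in> carrier A" "x \<in> carrier G" "a \<in> carrier A"
  shows "anchor (b \<odot>\<^bsub>G\<^esub> x) a = b \<otimes>\<^bsub>A\<^esub> anchor x a"
proof (rule sc_eqI)
  \<comment> \<open>The product has to stand in the second argument, where the Leibniz rule is
    stated. \<open>G.ext_vector_smult\<close> is withheld so that the scaled vector keeps the form
    expected by \<open>br_sc_vec\<close>.\<close>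
  have "sc (anchor (b \<odot>\<^bsub>G\<^esub> x) a) = \<ominus>\<^bsub>E\<^esub> br (sc a) (vec (b \<odot>\<^bsub>G\<^esub> x))"
    using assms by (simp add: br_sc_vec to_E del: G.ext_vector_smult)
  also have "\<dots> = \<ominus>\<^bsub>E\<^esub> br (sc a) (sc b \<otimes>\<^bsub>E\<^esub> vec x)"
    using assms by (simp add: to_E)
  also have "\<dots> = \<ominus>\<^bsub>E\<^esub> (sc b \<otimes>\<^bsub>E\<^esub> br (sc a) (vec x))"
    using assms by (simp add: br_leibniz[OF sc_power sc_power vec_power] br_sc_sc to_E)
  \<comment> \<open>Swapping back produces a second sign, which cancels the first.\<close>
  also have "\<dots> = sc (b \<otimes>\<^bsub>A\<^esub> anchor x a)"
    using assms by (simp add: br_sc_vec to_E E.r_minus)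
  finally show "sc (anchor (b \<odot>\<^bsub>G\<^esub> x) a) = sc (b \<otimes>\<^bsub>A\<^esub> anchor x a)" .
qed (use assms in \<open>simp_all add: anchor\<close>)

text \<open>The Jacobi identity for x, y, a in degrees 1, 1, 0. Antisymmetry turns its last two
  terms into -[y,[x,a]] and -[[x,y],a].\<close>

lemma anchor_bracket:
  assumes "x \<in> carrier G" "y \<in> carrier G" "a \<in> carrier A"
  shows "anchor (lb x y) a = anchor x (anchor y a) \<ominus>\<^bsub>A\<^esub> anchor y (anchor x a)"
proof -
  have "br (vec x) (br (vec y) (sc a)) \<oplus>\<^bsub>E\<^esub> br (vec y) (br (sc a) (vec x))
      \<oplus>\<^bsub>E\<^esub> br (sc a) (br (vec x) (vec y)) = \<zero>\<^bsub>E\<^esub>"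
    using assms by (intro br_jacobi[OF vec_power vec_power sc_power]) auto
  moreover have "br (sc a) (br (vec x) (vec y)) = \<ominus>\<^bsub>E\<^esub> br (br (vec x) (vec y)) (sc a)"
    using br_sc_vec[of "lb x y" a] assms by (simp add: lb)
  moreover have "br (vec y) (br (sc a) (vec x)) = \<ominus>\<^bsub>E\<^esub> br (vec y) (br (vec x) (sc a))"
    using assms by (simp add: br_sc_vec br_minus to_E)
  ultimately have *: "br (vec x) (br (vec y) (sc a)) \<oplus>\<^bsub>E\<^esub> \<ominus>\<^bsub>E\<^esub> br (vec y) (br (vec x) (sc a))
      \<oplus>\<^bsub>E\<^esub> \<ominus>\<^bsub>E\<^esub> br (br (vec x) (vec y)) (sc a) = \<zero>\<^bsub>E\<^esub>"
    by simp
  \<comment> \<open>The identity is rearranged without subtraction, because \<open>to_E\<close>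
    transports sums of scalars but has no rule for differences.\<close>
  have "P = R \<oplus>\<^bsub>E\<^esub> Q"
    if "P \<oplus>\<^bsub>E\<^esub> \<ominus>\<^bsub>E\<^esub> Q \<oplus>\<^bsub>E\<^esub> \<ominus>\<^bsub>E\<^esub> R = \<zero>\<^bsub>E\<^esub>" "P \<in> carrier E" "Q \<in> carrier E" "R \<in> carrier E"
    for P Q R
  proof (rule E.eq_if_minus_eq_zero)
    show "P \<ominus>\<^bsub>E\<^esub> (R \<oplus>\<^bsub>E\<^esub> Q) = \<zero>\<^bsub>E\<^esub>"
      using that by (simp add: E.minus_eq E.minus_add E.a_ac)
  qed (use that in auto)
  note ** = this[OF *]
  have "anchor x (anchor y a) = anchor (lb x y) a \<oplus>\<^bsub>A\<^esub> anchor y (anchor x a)"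
    by (rule sc_eqI) (use assms ** in \<open>simp_all add: to_E\<close>)
  moreover have "p \<oplus>\<^bsub>A\<^esub> q \<ominus>\<^bsub>A\<^esub> q = p" if "p \<in> carrier A" "q \<in> carrier A" for p q
    using that by (simp add: M.minus_eq M.a_assoc M.r_neg)
  ultimately show ?thesis
    using assms by (simp add: anchor lb)
qed

text \<open>The graded Leibniz rule for [x, a y] with a of degree 0, up to the order of the two
  summands.\<close>

lemma leibniz:
  assumes "a \<in> carrier A" "x \<in> carrier G" "y \<in> carrier G"
  shows "lb x (a \<odot>\<^bsub>G\<^esub> y) = a \<odot>\<^bsub>G\<^esub> lb x y \<oplus>\<^bsub>G\<^esub> anchor x a \<odot>\<^bsub>G\<^esub> y"
  by (rule vec_eqI)
     (use assms in \<open>simp_all add: to_E br_leibniz[OF vec_power sc_power vec_power] E.a_comm\<close>)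

section \<open>The Lie algebra structure on \<open>G\<close>\<close>

lemma lb_bilinear: "bilinear_on K (restrict_scalars K A G) lb"
proof -
  have "lb (x \<oplus>\<^bsub>G\<^esub> y) z = lb x z \<oplus>\<^bsub>G\<^esub> lb y z" "lb z (x \<oplus>\<^bsub>G\<^esub> y) = lb z x \<oplus>\<^bsub>G\<^esub> lb z y"
    if "x \<in> carrier G" "y \<in> carrier G" "z \<in> carrier G" for x y z
    by (rule vec_eqI; use that in \<open>simp add: to_E\<close>)+
  moreover have "lb ((k \<odot>\<^bsub>A\<^esub> \<one>\<^bsub>A\<^esub>) \<odot>\<^bsub>G\<^esub> x) y = (k \<odot>\<^bsub>A\<^esub> \<one>\<^bsub>A\<^esub>) \<odot>\<^bsub>G\<^esub> lb x y"
    "lb x ((k \<odot>\<^bsub>A\<^esub> \<one>\<^bsub>A\<^esub>) \<odot>\<^bsub>G\<^esub> y) = (k \<odot>\<^bsub>A\<^esub> \<one>\<^bsub>A\<^esub>) \<odot>\<^bsub>G\<^esub> lb x y"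
    if "k \<in> carrier K" "x \<in> carrier G" "y \<in> carrier G" for k x y
    by (rule vec_eqI; use that in \<open>simp add: to_E\<close>)+
  ultimately show ?thesis
    unfolding bilinear_on_def restrict_scalars_simps by (auto simp: lb)
qed

lemma lb_jacobi:
  assumes "x \<in> carrier G" "y \<in> carrier G" "z \<in> carrier G"
  shows "lb x (lb y z) \<oplus>\<^bsub>G\<^esub> lb y (lb z x) \<oplus>\<^bsub>G\<^esub> lb z (lb x y) = \<zero>\<^bsub>G\<^esub>"
  by (rule vec_eqI)
     (use assms in \<open>simp_all add: to_E G.ext_vector_zero br_jacobi[OF vec_power vec_power vec_power]\<close>)

text \<open>In degrees 1, 1 antisymmetry reads [x,x] = -[x,x]. Halving is left to
  \<open>double_eq_zero\<close>, applied to \<open>G\<close> as a module over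
  \<open>K\<close>.\<close>

lemma lb_double:
  assumes "x \<in> carrier G"
  shows "lb x x \<oplus>\<^bsub>G\<^esub> lb x x = \<zero>\<^bsub>G\<^esub>"
proof (rule vec_eqI)
  let ?P = "br (vec x) (vec x)"
  have "?P = \<ominus>\<^bsub>E\<^esub> ?P"
    by (rule br_antisym[OF vec_power[OF assms] vec_power[OF assms]]) simp
  then have "?P \<oplus>\<^bsub>E\<^esub> ?P = \<ominus>\<^bsub>E\<^esub> ?P \<oplus>\<^bsub>E\<^esub> ?P"
    by (rule arg_cong[where f = "\<lambda>Q. Q \<oplus>\<^bsub>E\<^esub> ?P"])
  also have "\<dots> = \<zero>\<^bsub>E\<^esub>"
    using assms by (simp add: E.l_neg to_E)
  finally have "?P \<oplus>\<^bsub>E\<^esub> ?P = \<zero>\<^bsub>E\<^esub>" .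
  then show "vec (lb x x \<oplus>\<^bsub>G\<^esub> lb x x) = vec \<zero>\<^bsub>G\<^esub>"
    using assms by (simp add: to_E G.ext_vector_zero)
qed (use assms in \<open>simp_all add: lb\<close>)

section \<open>Assembling the Lie-Rinehart axioms\<close>

lemma lie_rinehart_induced:
  assumes "field K" "\<one>\<^bsub>K\<^esub> \<oplus>\<^bsub>K\<^esub> \<one>\<^bsub>K\<^esub> \<noteq> \<zero>\<^bsub>K\<^esub>"
  shows "lie_rinehart K A G lb anchor"
proof -
  interpret L: module K "restrict_scalars K A G"
    by (rule restrict_scalars_module[OF G.module_axioms])
  have "lie_algebra K (restrict_scalars K A G) lb"
  proof (intro lie_algebra.intro lie_algebra_axioms.intro)
    fix x assume x: "x \<in> carrier (restrict_scalars K A G)"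
    show "lb x x = \<zero>\<^bsub>restrict_scalars K A G\<^esub>"
      by (rule L.double_eq_zero[OF assms])
         (use x in \<open>simp_all add: restrict_scalars_simps lb lb_double\<close>)
  qed (use L.module_axioms lb_bilinear lb_jacobi in \<open>simp_all add: restrict_scalars_simps\<close>)
  then show ?thesis
    by (intro lie_rinehart.intro lie_rinehart_axioms.intro algebra_axioms G.module_axioms
        anchor_Der anchor_add anchor_smult anchor_bracket leibniz)
qed

end

theorem proposition6p1:
  fixes K :: "('k, 'm) ring_scheme"
    and A :: "('k, 'a, 'n) module_scheme"
    and G :: "('a, 'g, 'p) module_scheme"
    and br :: "('g list \<Rightarrow> 'a) set \<Rightarrow> ('g list \<Rightarrow> 'a) set \<Rightarrow> ('g list \<Rightarrow> 'a) set"
  assumes "field K"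
    and "\<forall>n::nat. n > 0 \<longrightarrow> [n] \<cdot>\<^bsub>K\<^esub> \<one>\<^bsub>K\<^esub> \<noteq> \<zero>\<^bsub>K\<^esub>"
    and "algebra K A"
    and "module A G"
    and "gerstenhaber_bracket K (restrict_scalars K A (exterior_algebra A G))
           (exterior_power A G) br"
  shows "lie_rinehart K A G (induced_bracket A G br) (induced_anchor A G br)"
proof -
  interpret K: field K by (rule assms(1))
  interpret gerstenhaber_exterior K A G br
    using assms(3-5) by (intro gerstenhaber_exterior.intro gerstenhaber_exterior_axioms.intro)
  \<comment> \<open>Characteristic zero enters through n = 2, the factor to be inverted in 2 [x,x] =
    0.\<close>
  have "[(2::nat)] \<cdot>\<^bsub>K\<^esub> \<one>\<^bsub>K\<^esub> = \<one>\<^bsub>K\<^esub> \<oplus>\<^bsub>K\<^esub> \<one>\<^bsub>K\<^esub>"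
    by (simp add: numeral_2_eq_2)
  then have "\<one>\<^bsub>K\<^esub> \<oplus>\<^bsub>K\<^esub> \<one>\<^bsub>K\<^esub> \<noteq> \<zero>\<^bsub>K\<^esub>"
    using assms(2) by (metis zero_less_numeral)
  then show ?thesis
    by (rule lie_rinehart_induced[OF assms(1)])
qed

end
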